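(* There exist constants $C>0$ and $R>1$ such that for every $r\ge R$ and every nonzero bounded holomorphic function $f:\mathbb{H}_r\to\mathbb{C}$, $$\inf_{\hat f}\ \frac{\|\hat f\|_{\mathbb{D}^2}}{\|f\|_{\mathbb{H}_r}}\le 2+\frac{C}{r^2},$$ where the infimum is over all $\hat f\in H^\infty(\mathbb{D}^2)$ with $\hat f|_{\mathbb{H}_r}=f$.
   Context: $\mathbb{D}$ is the open unit disk in $\mathbb{C}$. For $r>1$, the conservative hyperbola is $\mathbb{H}_r=\{(z,w)\in\mathbb{D}^2 : zw=1/r^2\}$, a one-dimensional complex submanifold of the bidisk $\mathbb{D}^2$ (parametrized by $z\mapsto (z,1/(r^2z))$, $1/r^2<|z|<1$). $H^\infty(\mathbb{D}^2)$ is the space of bounded holomorphic functions $\mathbb{D}^2\to\mathbb{C}$. The norms are $\|\hat f\|_{\mathbb{D}^2}=\sup_{\mathbb{D}^2}|\hat f|$ and $\|f\|_{\mathbb{H}_r}=\sup_{\mathbb{H}_r}|f|$. *)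

theory Defs
  imports "HOL-Complex_Analysis.Complex_Analysis"
begin

definition unit_disk :: "complex set" where
  "unit_disk = ball 0 1"

definition bidisk :: "(complex \<times> complex) set" where
  "bidisk = unit_disk \<times> unit_disk"

definition hyperbola :: "real \<Rightarrow> (complex \<times> complex) set" where
  "hyperbola r = {(z, w). (z, w) \<in> bidisk \<and> z * w = 1 / (of_real r)\<^sup>2}"

definition annulus :: "real \<Rightarrow> complex set" where
  "annulus r = {z. 1 / r\<^sup>2 < norm z \<and> norm z < 1}"

definition hyperbola_param :: "real \<Rightarrow> complex \<Rightarrow> complex \<times> complex" where
  "hyperbola_param r z = (z, 1 / ((of_real r)\<^sup>2 * z))"

lemma hyperbola_param_bij_betw:
  assumes "r > 1"
  shows "bij_betw (hyperbola_param r) (annulus r) (hyperbola r)"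
proof (rule bij_betwI[where g = fst])
  show "hyperbola_param r \<in> annulus r \<rightarrow> hyperbola r"
  proof
    fix z assume z: "z \<in> annulus r"
    have r2: "r\<^sup>2 > 0" using assms by simp
    have lt: "1 / r\<^sup>2 < norm z" "norm z < 1" using z by (auto simp: annulus_def)
    have pos: "norm z > 0" using lt(1) r2 by (meson divide_pos_pos less_trans zero_less_one)
    have "1 < r\<^sup>2 * norm z" using lt(1) r2 by (simp add: field_simps)
    then have "norm (1 / ((of_real r)\<^sup>2 * z)) < 1"
      using r2 pos by (simp add: norm_divide norm_mult norm_power divide_simps)
    then show "hyperbola_param r z \<in> hyperbola r"
      using lt pos assms
      by (auto simp: hyperbola_param_def hyperbola_def bidisk_def unit_disk_def)
  qed
next
  have "fst p \<in> annulus r \<and> hyperbola_param r (fst p) = p" if p: "p \<in> hyperbola r" for p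
  proof -
    obtain z w where zw: "p = (z, w)" by (cases p)
    have *: "norm z < 1" "norm w < 1" "z * w = 1 / (of_real r)\<^sup>2"
      using p by (auto simp: zw hyperbola_def bidisk_def unit_disk_def)
    have z0: "z \<noteq> 0" using *(3) assms by auto
    have "norm z * norm w = 1 / r\<^sup>2"
      using arg_cong[OF *(3), of norm] by (simp add: norm_mult norm_divide norm_power)
    moreover have "norm z * norm w < norm z * 1"
      using z0 *(2) by (intro mult_strict_left_mono) auto
    moreover have "w = 1 / ((of_real r)\<^sup>2 * z)"
      using *(3) z0 assms by (simp add: field_simps)
    ultimately show ?thesis using * by (simp add: zw annulus_def hyperbola_param_def)
  qed
  then show "fst \<in> hyperbola r \<rightarrow> annulus r"
    and "\<And>p. p \<in> hyperbola r \<Longrightarrow> hyperbola_param r (fst p) = p" by auto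
qed (simp add: hyperbola_param_def)

text \<open>Holomorphy on the submanifold is read off in its global chart, the inverse of
  \<^term>\<open>hyperbola_param r\<close>.\<close>

definition holomorphic_on_hyperbola :: "real \<Rightarrow> (complex \<times> complex \<Rightarrow> complex) \<Rightarrow> bool" where
  "holomorphic_on_hyperbola r f \<longleftrightarrow> (f \<circ> hyperbola_param r) holomorphic_on annulus r"

text \<open>Holomorphy in two variables on an open set: a complex-linear Frechet derivative at each
  point. The set is meant to be open, as the derivative is not taken within \<^term>\<open>U\<close>.\<close>

definition holomorphic2_on ::
  "(complex \<times> complex \<Rightarrow> complex) \<Rightarrow> (complex \<times> complex) set \<Rightarrow> bool" where
  "holomorphic2_on F U \<longleftrightarrow>
     (\<forall>p\<in>U. \<exists>a b. (F has_derivative (\<lambda>(h, k). a * h + b * k)) (at p))"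

definition H_infinity :: "(complex \<times> complex) set \<Rightarrow> (complex \<times> complex \<Rightarrow> complex) set" where
  "H_infinity U = {F. holomorphic2_on F U \<and> bounded (F ` U)}"

text \<open>A supremum of reals: only meaningful for functions bounded on a nonempty set.\<close>

definition sup_norm :: "(complex \<times> complex) set \<Rightarrow> (complex \<times> complex \<Rightarrow> complex) \<Rightarrow> real" where
  "sup_norm S f = (SUP p\<in>S. norm (f p))"

definition bounded_extensions ::
  "real \<Rightarrow> (complex \<times> complex \<Rightarrow> complex) \<Rightarrow> (complex \<times> complex \<Rightarrow> complex) set" where
  "bounded_extensions r f = {F \<in> H_infinity bidisk. \<forall>p\<in>hyperbola r. F p = f p}"

text \<open>The infimum is taken in \<^typ>\<open>ereal\<close>, so that it is infinite if there is no extension;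
  over the reals the infimum of the empty set would be an arbitrary number.\<close>

definition extension_constant :: "real \<Rightarrow> (complex \<times> complex \<Rightarrow> complex) \<Rightarrow> ereal" where
  "extension_constant r f =
     (INF F\<in>bounded_extensions r f. ereal (sup_norm bidisk F / sup_norm (hyperbola r) f))"

end

theory Submission
  imports Defs
begin

text \<open>
  Put \<open>s = 1 / r\<^sup>2\<close> and normalise the given function on the hyperbola to have supremum 1. In the
  chart it is a function \<open>\<phi>\<close> on the annulus \<open>s < |z| < 1\<close>, and by the Cauchy formula on two circles it
  splits as \<open>\<phi>(z) = g(z) + h(s/z)\<close> with \<open>g\<close>, \<open>h\<close> holomorphic on the disc and \<open>h(0) = 0\<close>
  (\<open>annulus_splitting\<close>). Let \<open>a = g(0)\<close>, \<open>G(z) = g(z)\<close> and \<open>H(w) = h(w) + a\<close>. Near the outer circle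
  \<open>w = s/z\<close> is close to 0, so \<open>G\<close> is nearly \<open>\<phi>\<close> there, and symmetrically for \<open>H\<close>; with the
  maximum principle and the Schwarz lemma both are bounded by \<open>1 + O(s)\<close> (\<open>splitting_bounds\<close>).

  The obvious extension \<open>G(z) + H(w) - a\<close> may have norm close to 3. In the degenerate case
  \<open>zw = 0\<close> a better one is
  \<open>F\<^sub>0(z, w) = (G(z) + H(w) - a + cnj a * G(z) * H(w)) / (1 + |a|\<^sup>2)\<close>,
  which still restricts to \<open>G\<close> where \<open>H = a\<close> and to \<open>H\<close> where \<open>G = a\<close>. Its numerator is
  \<open>G (1 + cnj a H) + (H - a)\<close>, and the identity
  \<open>|1 + cnj a H|\<^sup>2 + |H - a|\<^sup>2 = (1 + |a|\<^sup>2)(1 + |H|\<^sup>2)\<close> with Cauchy-Schwarz bounds \<open>F\<^sub>0\<close> by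
  \<open>1 + M\<^sup>2 = 2 + O(s)\<close> when \<open>|G|, |H| \<le> M = 1 + O(s)\<close> (\<open>bilinear_bound\<close>).

  On the hyperbola itself \<open>F\<^sub>0\<close> exceeds \<open>G + H - a\<close> by \<open>cnj a (G - a)(H - a) / (1 + |a|\<^sup>2)\<close>. Writing
  \<open>G - a = z g\<^sub>1(z)\<close> and \<open>H - a = w h\<^sub>1(w)\<close>, the product is \<open>zw g\<^sub>1(z) h\<^sub>1(w) = s g\<^sub>1(z) h\<^sub>1(w)\<close>, which
  extends to the bidisk with norm \<open>O(s)\<close> and can be subtracted (\<open>bilinear_extension\<close>).
\<close>

section \<open>The maximum principle on discs\<close>

lemma max_modulus_disc:
  fixes \<phi> :: "complex \<Rightarrow> complex"
  assumes hol: "\<phi> holomorphic_on ball 0 1" and t: "0 < t" "t < 1"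
    and bound: "\<And>z. norm z = t \<Longrightarrow> norm (\<phi> z) \<le> B"
    and z: "norm z \<le> t"
  shows "norm (\<phi> z) \<le> B"
proof (rule maximum_modulus_frontier[where S = "cball 0 t" and f = \<phi>])
  show "\<phi> holomorphic_on interior (cball 0 t)"
    by (rule holomorphic_on_subset[OF hol]) (use t in auto)
  show "continuous_on (closure (cball 0 t)) \<phi>"
    by (rule continuous_on_subset[OF holomorphic_on_imp_continuous_on[OF hol]]) (use t in auto)
qed (use bound z in auto)

lemma holomorphic_divide_zero:
  fixes \<phi> :: "complex \<Rightarrow> complex"
  assumes "\<phi> holomorphic_on ball 0 1" "\<phi> 0 = 0"
  obtains \<psi> where "\<psi> holomorphic_on ball 0 1" "\<And>z. \<phi> z = z * \<psi> z"
proof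
  show "(\<lambda>z. if z = 0 then deriv \<phi> 0 else (\<phi> z - \<phi> 0) / (z - 0)) holomorphic_on ball 0 1"
    using assms by (intro pole_lemma_open) auto
qed (use assms in auto)

lemma divide_zero_bound:
  fixes \<phi> :: "complex \<Rightarrow> complex"
  assumes "\<psi> holomorphic_on ball 0 1" "\<And>z. \<phi> z = z * \<psi> z"
    and t: "0 < t" "t < 1" and bound: "\<And>z. norm z = t \<Longrightarrow> norm (\<phi> z) \<le> B"
    and z: "norm z \<le> t"
  shows "norm (\<psi> z) \<le> B / t"
proof (rule max_modulus_disc[OF assms(1) t _ z])
  fix z :: complex assume "norm z = t"
  with bound[of z] show "norm (\<psi> z) \<le> B / t"
    using t by (simp add: assms(2) norm_mult field_simps)
qed

lemma schwarz_bound: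
  fixes \<phi> :: "complex \<Rightarrow> complex"
  assumes "\<phi> holomorphic_on ball 0 1" "\<phi> 0 = 0"
    and t: "0 < t" "t < 1" and bound: "\<And>z. norm z = t \<Longrightarrow> norm (\<phi> z) \<le> B"
    and z: "norm z \<le> t"
  shows "norm (\<phi> z) \<le> norm z * (B / t)"
proof -
  obtain \<psi> where \<psi>: "\<psi> holomorphic_on ball 0 1" "\<And>z. \<phi> z = z * \<psi> z"
    using holomorphic_divide_zero assms(1,2) by blast
  show ?thesis
    using mult_left_mono[OF divide_zero_bound[OF \<psi> t bound z], of "norm z"]
    by (simp add: \<psi>(2) norm_mult)
qed

section \<open>Splitting a function on an annulus\<close>

lemma cauchy_transform_holomorphic:
  fixes \<phi> :: "complex \<Rightarrow> complex"
  assumes "0 < \<rho>" "continuous_on (sphere 0 \<rho>) \<phi>"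
  shows "(\<lambda>z. contour_integral (circlepath 0 \<rho>) (\<lambda>\<zeta>. \<phi> \<zeta> / (\<zeta> - z))) holomorphic_on (- sphere 0 \<rho>)"
proof -
  let ?f = "\<lambda>z. contour_integral (circlepath 0 \<rho>) (\<lambda>\<zeta>. \<phi> \<zeta> / (\<zeta> - z))"
  have int: "((\<lambda>u. \<phi> u / (u - w) ^ 1) has_contour_integral ?f w) (circlepath 0 \<rho>)"
    if "w \<in> UNIV - path_image (circlepath 0 \<rho>)" for w
  proof -
    have "(\<lambda>u. \<phi> u / (u - w)) contour_integrable_on circlepath 0 \<rho>"
      by (rule contour_integrable_continuous_circlepath)
         (use assms that in \<open>auto intro!: continuous_intros\<close>)
    then show ?thesis by (simp add: has_contour_integral_integral)
  qed
  have "(?f has_field_derivative (of_nat 1 * contour_integral (circlepath 0 \<rho>)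
          (\<lambda>u. \<phi> u / (u - w) ^ Suc 1))) (at w)" if "w \<in> - sphere 0 \<rho>" for w
    by (rule Cauchy_next_derivative(2)[where S = UNIV and B = "2 * pi * \<rho>"])
       (use assms that int in \<open>auto simp: vector_derivative_circlepath norm_mult\<close>)
  then show ?thesis
    unfolding holomorphic_on_open[OF open_Compl[OF closed_sphere]] by blast
qed

text \<open>The difference quotient \<open>q\<close> of \<open>\<phi>\<close> at \<open>z\<close> is holomorphic on the whole annulus, so its integrals
  over the two homotopic circles agree. Adding back \<open>\<phi>(z) / (\<zeta> - z)\<close> contributes \<open>2 \<pi> i \<phi>(z)\<close> on
  the outer circle, which surrounds \<open>z\<close>, and 0 on the inner one.\<close>

lemma cauchy_annulus:
  fixes \<phi> :: "complex \<Rightarrow> complex"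
  assumes hol: "\<phi> holomorphic_on {z. s < norm z \<and> norm z < 1}" and s: "0 < s"
    and \<rho>: "s < \<rho>1" "\<rho>1 < \<rho>2" "\<rho>2 < 1" and z: "\<rho>1 < norm z" "norm z < \<rho>2"
  shows "contour_integral (circlepath 0 \<rho>2) (\<lambda>\<zeta>. \<phi> \<zeta> / (\<zeta> - z))
       - contour_integral (circlepath 0 \<rho>1) (\<lambda>\<zeta>. \<phi> \<zeta> / (\<zeta> - z)) = 2 * pi * \<i> * \<phi> z"
proof -
  define U where "U = {z::complex. s < norm z \<and> norm z < 1}"
  have oU: "open U"
    unfolding U_def by (intro open_Collect_conj open_Collect_less continuous_intros)
  define q where "q = (\<lambda>\<zeta>. if \<zeta> = z then deriv \<phi> z else (\<phi> \<zeta> - \<phi> z) / (\<zeta> - z))"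
  have qhol: "q holomorphic_on U"
    unfolding q_def using hol oU by (intro pole_lemma_open) (auto simp: U_def)
  have hom: "homotopic_loops U (circlepath 0 \<rho>1) (circlepath 0 \<rho>2)"
  proof (rule homotopic_loops_linear)
    fix t :: real
    have "cmod x \<in> {\<rho>1..\<rho>2}" if xs: "x \<in> closed_segment (circlepath 0 \<rho>1 t) (circlepath 0 \<rho>2 t)" for x
    proof -
      obtain u where u: "0 \<le> u" "u \<le> 1"
        and x: "x = (1 - u) *\<^sub>R circlepath 0 \<rho>1 t + u *\<^sub>R circlepath 0 \<rho>2 t"
        using xs unfolding in_segment(1) by blast
      have "x = of_real ((1 - u) * \<rho>1 + u * \<rho>2) * exp (\<i> * of_real (2 * pi * t))"
        by (simp add: x circlepath scaleR_conv_of_real algebra_simps)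
      then have "cmod x = \<bar>(1 - u) * \<rho>1 + u * \<rho>2\<bar>"
        by (simp only: norm_mult norm_of_real norm_exp_i_times mult_1_right)
      moreover have "(1 - u) * \<rho>1 + u * \<rho>2 = \<rho>1 + u * (\<rho>2 - \<rho>1)"
        "(1 - u) * \<rho>1 + u * \<rho>2 = \<rho>2 - (1 - u) * (\<rho>2 - \<rho>1)"
        by (simp_all add: algebra_simps)
      moreover have "0 \<le> u * (\<rho>2 - \<rho>1)" "0 \<le> (1 - u) * (\<rho>2 - \<rho>1)" using u \<rho> by auto
      ultimately show ?thesis using s \<rho> by auto
    qed
    then show "closed_segment (circlepath 0 \<rho>1 t) (circlepath 0 \<rho>2 t) \<subseteq> U"
      using \<rho> by (force simp: U_def)
  qed auto
  have q_eq: "contour_integral (circlepath 0 \<rho>1) q = contour_integral (circlepath 0 \<rho>2) q"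
    by (rule Cauchy_theorem_homotopic_loops[OF hom oU qhol]) auto
  have split: "contour_integral (circlepath 0 \<rho>) (\<lambda>\<zeta>. \<phi> \<zeta> / (\<zeta> - z))
       = contour_integral (circlepath 0 \<rho>) q + \<phi> z * k"
    if \<rho>': "\<rho> \<in> {\<rho>1, \<rho>2}" and k: "((\<lambda>\<zeta>. 1 / (\<zeta> - z)) has_contour_integral k) (circlepath 0 \<rho>)" for \<rho> k
  proof (rule contour_integral_unique)
    have "q contour_integrable_on circlepath 0 \<rho>"
      by (rule contour_integrable_continuous_circlepath,
          rule continuous_on_subset[OF holomorphic_on_imp_continuous_on[OF qhol]])
         (use \<rho>' \<rho> s in \<open>auto simp: U_def\<close>)
    then have "((\<lambda>\<zeta>. q \<zeta> + \<phi> z * (1 / (\<zeta> - z))) has_contour_integral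
        contour_integral (circlepath 0 \<rho>) q + \<phi> z * k) (circlepath 0 \<rho>)"
      by (intro has_contour_integral_add has_contour_integral_lmul k has_contour_integral_integral)
    then show "((\<lambda>\<zeta>. \<phi> \<zeta> / (\<zeta> - z)) has_contour_integral
        contour_integral (circlepath 0 \<rho>) q + \<phi> z * k) (circlepath 0 \<rho>)"
      by (rule has_contour_integral_eq)
         (use \<rho>' \<rho> s z in \<open>auto simp: q_def divide_simps\<close>)
  qed
  have "((\<lambda>\<zeta>. 1 / (\<zeta> - z)) has_contour_integral 2 * of_real pi * \<i> * 1) (circlepath 0 \<rho>2)"
    by (rule Cauchy_integral_circlepath_simple[where f = "\<lambda>_. 1"]) (use z in auto)
  moreover have "((\<lambda>\<zeta>. 1 / (\<zeta> - z)) has_contour_integral 0) (circlepath 0 \<rho>1)"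
    by (rule Cauchy_theorem_convex_simple[where S = "ball 0 (norm z)"])
       (use z s \<rho> in \<open>auto intro!: holomorphic_intros\<close>)
  ultimately show ?thesis
    using split[of \<rho>2] split[of \<rho>1] by (simp add: q_eq)
qed

text \<open>A Laurent splitting without Laurent series. The Cauchy transform \<open>c \<rho>2\<close> gives \<open>g\<close> inside the circle
  of radius \<open>\<rho>2\<close> only, but on the overlap it equals \<open>\<phi> + c \<rho>1\<close>, which is holomorphic up to the
  unit circle; the two glue to \<open>g\<close>. In the same way \<open>- c \<rho>1\<close> and \<open>\<phi> - c \<rho>2\<close> glue to a function
  \<open>L\<close> on \<open>|z| > s\<close>. It tends to 0 at infinity, so \<open>L(s/w)\<close> has a removable singularity at 0.\<close>

lemma annulus_splitting:
  fixes \<phi> :: "complex \<Rightarrow> complex"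
  assumes hol: "\<phi> holomorphic_on {z. s < norm z \<and> norm z < 1}" and s: "0 < s" "s < 1"
  obtains g h where "g holomorphic_on ball 0 1" "h holomorphic_on ball 0 1" "h 0 = 0"
    "\<And>z. s < norm z \<Longrightarrow> norm z < 1 \<Longrightarrow> \<phi> z = g z + h (of_real s / z)"
proof -
  define \<rho>1 where "\<rho>1 = s + (1 - s) / 3"
  define \<rho>2 where "\<rho>2 = s + (1 - s) * 2 / 3"
  have \<rho>: "s < \<rho>1" "\<rho>1 < \<rho>2" "\<rho>2 < 1" "0 < \<rho>1" "0 < \<rho>2"
    using s by (auto simp: \<rho>1_def \<rho>2_def field_simps)
  define c :: "real \<Rightarrow> complex \<Rightarrow> complex"
    where "c = (\<lambda>\<rho> z. contour_integral (circlepath 0 \<rho>) (\<lambda>\<zeta>. \<phi> \<zeta> / (\<zeta> - z)) / (2 * pi * \<i>))"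
  have cont: "continuous_on (sphere 0 \<rho>) \<phi>" if "\<rho> \<in> {\<rho>1, \<rho>2}" for \<rho>
    by (rule continuous_on_subset[OF holomorphic_on_imp_continuous_on[OF hol]]) (use that \<rho> in auto)
  have chol: "c \<rho> holomorphic_on (- sphere 0 \<rho>)" if "\<rho> \<in> {\<rho>1, \<rho>2}" for \<rho>
    unfolding c_def using that \<rho> cont[OF that]
    by (intro holomorphic_intros cauchy_transform_holomorphic) auto
  have c_eq: "c \<rho>2 z - c \<rho>1 z = \<phi> z" if "\<rho>1 < norm z" "norm z < \<rho>2" for z
    using cauchy_annulus[OF hol s(1) \<rho>(1-3) that] by (simp add: c_def diff_divide_distrib[symmetric])
  define g where "g = (\<lambda>z. if norm z < \<rho>2 then c \<rho>2 z else \<phi> z + c \<rho>1 z)"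
  have ghol: "g holomorphic_on ball 0 1"
  proof -
    have "g holomorphic_on ball 0 \<rho>2 \<union> {z. \<rho>1 < norm z \<and> norm z < 1}"
    proof (rule holomorphic_on_Un)
      show "g holomorphic_on ball 0 \<rho>2"
        by (rule holomorphic_transform[OF holomorphic_on_subset[OF chol[of \<rho>2]]]) (auto simp: g_def)
      have "(\<lambda>z. \<phi> z + c \<rho>1 z) holomorphic_on {z. \<rho>1 < norm z \<and> norm z < 1}"
        by (intro holomorphic_on_add holomorphic_on_subset[OF hol] holomorphic_on_subset[OF chol])
           (use \<rho> in auto)
      then show "g holomorphic_on {z. \<rho>1 < norm z \<and> norm z < 1}"
        by (rule holomorphic_transform) (use c_eq in \<open>auto simp: g_def algebra_simps\<close>)
      show "open {z::complex. \<rho>1 < norm z \<and> norm z < 1}"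
        by (intro open_Collect_conj open_Collect_less continuous_intros)
    qed auto
    then show ?thesis by (rule holomorphic_on_subset) (use \<rho> in auto)
  qed
  define L where "L = (\<lambda>z. if norm z > \<rho>1 then - c \<rho>1 z else \<phi> z - c \<rho>2 z)"
  have L_eq: "\<phi> z = g z + L z" if "s < norm z" "norm z < 1" for z
    using that c_eq[of z] \<rho> by (auto simp: L_def g_def algebra_simps)
  have Lhol: "L holomorphic_on {z. s < norm z}"
  proof -
    have "L holomorphic_on {z. \<rho>1 < norm z} \<union> {z. s < norm z \<and> norm z < \<rho>2}"
    proof (rule holomorphic_on_Un)
      have "(\<lambda>z. - c \<rho>1 z) holomorphic_on {z. \<rho>1 < norm z}"
        by (intro holomorphic_on_minus holomorphic_on_subset[OF chol]) auto
      then show "L holomorphic_on {z. \<rho>1 < norm z}"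
        by (rule holomorphic_transform) (auto simp: L_def)
      have "(\<lambda>z. \<phi> z - c \<rho>2 z) holomorphic_on {z. s < norm z \<and> norm z < \<rho>2}"
        by (intro holomorphic_on_diff holomorphic_on_subset[OF hol] holomorphic_on_subset[OF chol])
           (use \<rho> in auto)
      then show "L holomorphic_on {z. s < norm z \<and> norm z < \<rho>2}"
        by (rule holomorphic_transform) (use c_eq in \<open>auto simp: L_def algebra_simps\<close>)
    qed (intro open_Collect_conj open_Collect_less continuous_intros)+
    then show ?thesis by (rule holomorphic_on_subset) (use \<rho> in auto)
  qed
  obtain B where B: "\<And>z. z \<in> sphere 0 \<rho>1 \<Longrightarrow> norm (\<phi> z) \<le> B"
    using compact_imp_bounded[OF compact_continuous_image[OF cont[of \<rho>1] compact_sphere]]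
    unfolding bounded_iff by blast
  have B0: "B \<ge> 0" using B[of "of_real \<rho>1"] \<rho> order_trans[OF norm_ge_zero] by simp
  have decay: "norm (L z) \<le> \<rho>1 * B / (norm z - \<rho>1)" if z: "norm z > \<rho>1" for z
  proof -
    have "(\<lambda>\<zeta>. \<phi> \<zeta> / (\<zeta> - z)) contour_integrable_on circlepath 0 \<rho>1"
      by (rule contour_integrable_continuous_circlepath)
         (use cont[of \<rho>1] \<rho> z in \<open>auto intro!: continuous_intros\<close>)
    then have "norm (contour_integral (circlepath 0 \<rho>1) (\<lambda>\<zeta>. \<phi> \<zeta> / (\<zeta> - z)))
        \<le> B / (norm z - \<rho>1) * (2 * pi * \<rho>1)"
    proof (rule has_contour_integral_bound_circlepath[OF has_contour_integral_integral])
      fix x :: complex assume x: "norm (x - 0) = \<rho>1"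
      have "norm z - \<rho>1 \<le> norm (x - z)" using x norm_triangle_ineq2[of z x] by (simp add: norm_minus_commute)
      then show "norm (\<phi> x / (x - z)) \<le> B / (norm z - \<rho>1)"
        using B[of x] x z B0 by (simp add: norm_divide frac_le)
    qed (use B0 \<rho> z in auto)
    then show ?thesis using z by (simp add: L_def c_def norm_divide norm_mult field_simps)
  qed
  define h where "h = (\<lambda>w. if w = 0 then 0 else L (of_real s / w))"
  have "h holomorphic_on ball 0 1"
    unfolding h_def
  proof (rule removable_singularity)
    have "(L \<circ> (\<lambda>w. of_real s / w)) holomorphic_on ball 0 1 - {0}"
      by (rule holomorphic_on_compose_gen[OF _ Lhol])
         (use s in \<open>auto intro!: holomorphic_intros simp: norm_divide field_simps\<close>)
    then show "(\<lambda>w. L (of_real s / w)) holomorphic_on ball 0 1 - {0}" by (simp add: o_def)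
    show "(\<lambda>w. L (of_real s / w)) \<midarrow>0\<rightarrow> 0"
    proof (rule Lim_null_comparison)
      have "\<forall>\<^sub>F w in at (0::complex). w \<in> ball 0 (s / \<rho>1) - {0}"
        using \<rho> s by (intro eventually_at_in_open) auto
      then show "\<forall>\<^sub>F w in at 0. norm (L (of_real s / w)) \<le> \<rho>1 * B * norm w / (s - norm w * \<rho>1)"
      proof eventually_elim
        case (elim w)
        then have w: "norm w > 0" "norm w * \<rho>1 < s" using \<rho> by (auto simp: field_simps)
        have "norm (L (of_real s / w)) \<le> \<rho>1 * B / (norm (of_real s / w) - \<rho>1)"
          by (rule decay) (use w s in \<open>simp add: norm_divide field_simps\<close>)
        also have "\<dots> = \<rho>1 * B * norm w / (s - norm w * \<rho>1)"
          using w s by (simp add: norm_divide field_simps)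
        finally show ?case .
      qed
      have "((\<lambda>w::complex. \<rho>1 * B * norm w / (s - norm w * \<rho>1)) \<longlongrightarrow> \<rho>1 * B * norm (0::complex) / (s - norm (0::complex) * \<rho>1)) (at 0)"
        by (intro tendsto_intros) (use s in auto)
      then show "((\<lambda>w::complex. \<rho>1 * B * norm w / (s - norm w * \<rho>1)) \<longlongrightarrow> 0) (at 0)" by simp
    qed
  qed auto
  moreover have "\<phi> z = g z + h (of_real s / z)" if "s < norm z" "norm z < 1" for z
    using L_eq[OF that] that s by (auto simp: h_def)
  ultimately show ?thesis
    using that[OF ghol, of h] by (simp add: h_def)
qed

section \<open>The two parts are almost bounded by one\<close>

text \<open>Let \<open>A\<close> and \<open>B\<close> be the maxima of \<open>|g|\<close> and \<open>|h|\<close> on a circle of radius \<open>t < 1\<close>. If \<open>|z| = t\<close>, then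
  \<open>s/z\<close> is small and the Schwarz lemma gives \<open>A \<le> 1 + (s/t\<^sup>2) B\<close>; exchanging the roles,
  \<open>B \<le> 1 + A\<close>. Together they bound \<open>A\<close>, and then the same argument applied to \<open>g - g(0)\<close> bounds
  \<open>h + g(0)\<close>. Keeping \<open>t \<ge> 3/4\<close> makes \<open>s/t\<^sup>2 \<le> 2s\<close>, a bound uniform in \<open>t\<close>.\<close>

lemma splitting_bounds:
  fixes g h :: "complex \<Rightarrow> complex"
  assumes g: "g holomorphic_on ball 0 1" and h: "h holomorphic_on ball 0 1" "h 0 = 0"
    and s: "0 < s" "s \<le> 1/4"
    and bound: "\<And>z. s < norm z \<Longrightarrow> norm z < 1 \<Longrightarrow> norm (g z + h (of_real s / z)) \<le> 1"
    and x: "norm x < 1"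
  shows "norm (g x) \<le> 1 + 8 * s" and "norm (h x + g 0) \<le> 1 + 12 * s"
proof -
  define t where "t = max (norm x) (3/4)"
  have t: "3/4 \<le> t" "t < 1" "0 < t" "norm x \<le> t" using x by (auto simp: t_def)
  have t2: "9/16 \<le> t * t" using mult_mono[OF t(1) t(1)] t by simp
  have st: "s / t < t" "s < t" using s t t2 by (auto simp: field_simps)
  have \<sigma>: "s / t / t \<le> 2 * s"
  proof -
    have "s * 1 \<le> s * (2 * (t * t))" using t2 s by (intro mult_left_mono) auto
    then show ?thesis using t by (simp add: field_simps)
  qed
  have sub: "sphere 0 t \<subseteq> ball (0::complex) 1" using t by auto
  have att: "\<exists>z\<in>sphere 0 t. \<forall>y\<in>sphere 0 t. norm (f y) \<le> norm (f z)"
    if "f holomorphic_on ball 0 1" for f :: "complex \<Rightarrow> complex"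
  proof (rule continuous_attains_sup)
    show "continuous_on (sphere 0 t) (\<lambda>z. norm (f z))"
      by (intro continuous_on_norm continuous_on_subset[OF holomorphic_on_imp_continuous_on[OF that] sub])
  qed (use t in auto)
  obtain u where u: "norm u = t" "\<And>z. norm z = t \<Longrightarrow> norm (g z) \<le> norm (g u)"
    using att[OF g] by auto
  obtain v where v: "norm v = t" "\<And>z. norm z = t \<Longrightarrow> norm (h z) \<le> norm (h v)"
    using att[OF h(1)] by auto
  define A where "A = norm (g u)"
  define B where "B = norm (h v)"
  have gA: "norm (g z) \<le> A" if "norm z \<le> t" for z
    using max_modulus_disc[OF g t(3,2) _ that] u A_def by auto
  have "A \<le> 1 + norm (h (of_real s / u))"
    using bound[of u] u st t norm_triangle_ineq4[of "g u + h (of_real s / u)" "h (of_real s / u)"]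
    by (simp add: A_def)
  also have "norm (h (of_real s / u)) \<le> norm (of_real s / u) * (B / t)"
    by (rule schwarz_bound[OF h t(3,2)]) (use v u s st in \<open>auto simp: B_def norm_divide\<close>)
  also have "\<dots> = s / t / t * B" using s u by (simp add: norm_divide)
  also have "\<dots> \<le> 2 * s * B" using \<sigma> by (intro mult_right_mono) (auto simp: B_def)
  finally have A: "A \<le> 1 + 2 * s * B" by simp
  have inv: "s < norm (of_real s / v)" "norm (of_real s / v) \<le> t" "norm (of_real s / v) < 1"
    "of_real s / (of_real s / v) = v" if "norm v = t" for v :: complex
    using that s st t by (auto simp: norm_divide field_simps)
  have "B \<le> 1 + norm (g (of_real s / v))"
    using bound[of "of_real s / v"] inv[OF v(1)]
      norm_triangle_ineq4[of "g (of_real s / v) + h v" "g (of_real s / v)"]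
    by (simp add: B_def)
  also have "norm (g (of_real s / v)) \<le> A" by (rule gA) (use inv[OF v(1)] in auto)
  finally have B: "B \<le> 1 + A" by simp
  have "A \<le> 1 + 2 * s * (1 + A)"
    using A mult_left_mono[OF B, of "2 * s"] s by linarith
  then have "A * (1 - 2 * s) \<le> 1 + 2 * s" by (simp add: algebra_simps)
  also have "\<dots> \<le> (1 + 8 * s) * (1 - 2 * s)"
    using mult_left_mono[OF s(2), of s] s by (simp add: algebra_simps)
  finally have A8: "A \<le> 1 + 8 * s" using s by (simp add: mult_le_cancel_right)
  show "norm (g x) \<le> 1 + 8 * s" using gA[OF t(4)] A8 by linarith
  show "norm (h x + g 0) \<le> 1 + 12 * s"
  proof (rule max_modulus_disc[OF _ t(3,2) _ t(4), where \<phi> = "\<lambda>z. h z + g 0"])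
    show "(\<lambda>z. h z + g 0) holomorphic_on ball 0 1" using h by (intro holomorphic_intros)
    fix w :: complex assume w: "norm w = t"
    define z where "z = of_real s / w"
    have z: "norm z \<le> t" "norm z = s / t" using inv[OF w] w s by (auto simp: z_def norm_divide)
    have "norm (g z - g 0) \<le> norm z * (6 / t)"
    proof (rule schwarz_bound[OF _ _ t(3,2) _ z(1), where \<phi> = "\<lambda>z. g z - g 0"])
      show "(\<lambda>z. g z - g 0) holomorphic_on ball 0 1" using g by (intro holomorphic_intros)
      show "norm (g y - g 0) \<le> 6" if "norm y = t" for y
        using gA[of y] gA[of 0] that t A8 s norm_triangle_ineq4[of "g y" "g 0"] by auto
    qed auto
    also have "\<dots> = 6 * (s / t / t)" by (simp add: z)
    finally have "norm (g z - g 0) \<le> 12 * s" using \<sigma> by linarith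
    moreover have "norm (g z + h w) \<le> 1"
      using bound[of z] inv[OF w] by (simp add: z_def)
    moreover have "h w + g 0 = (g z + h w) - (g z - g 0)" by simp
    ultimately show "norm (h w + g 0) \<le> 1 + 12 * s"
      using norm_triangle_ineq4[of "g z + h w" "g z - g 0"] by simp
  qed
qed

section \<open>The bilinear extension\<close>

text \<open>The argument even gives \<open>(1 + M\<^sup>2) / sqrt (1 + |a|\<^sup>2)\<close>. For \<open>M = 1\<close> this reaches
  2 only at \<open>a = 0\<close>, where the expression is \<open>G + H\<close>.\<close>

lemma bilinear_bound:
  fixes G H a :: complex
  assumes "norm G \<le> M" "norm H \<le> M"
  shows "norm ((G + H - a + cnj a * G * H) / (1 + (norm a)\<^sup>2)) \<le> 1 + M\<^sup>2"
proof -
  have M: "0 \<le> M" using assms(1) norm_ge_zero[of G] by linarith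
  define x where "x = norm (1 + cnj a * H)"
  define y where "y = norm (H - a)"
  have xy: "x\<^sup>2 + y\<^sup>2 = (1 + (norm a)\<^sup>2) * (1 + (norm H)\<^sup>2)"
    unfolding x_def y_def cmod_power2 by (simp add: power2_eq_square algebra_simps)
  have "norm (G + H - a + cnj a * G * H) = norm (G * (1 + cnj a * H) + (H - a))"
    by (simp add: algebra_simps)
  also have "\<dots> \<le> norm G * x + y"
    using norm_triangle_ineq[of "G * (1 + cnj a * H)" "H - a"] by (simp add: x_def y_def norm_mult)
  also have "\<dots> \<le> M * x + y" using assms by (simp add: x_def mult_right_mono)
  finally have 1: "norm (G + H - a + cnj a * G * H) \<le> M * x + y" .
  \<comment> \<open>Cauchy-Schwarz for the vectors \<open>(M, 1)\<close> and \<open>(x, y)\<close>\<close>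
  have "(M * x + y)\<^sup>2 \<le> (1 + M\<^sup>2) * (x\<^sup>2 + y\<^sup>2)"
    using zero_le_power2[of "M * y - x"] by (simp add: power2_eq_square algebra_simps)
  also have "\<dots> \<le> (1 + M\<^sup>2) * ((1 + (norm a)\<^sup>2) * (1 + M\<^sup>2))"
    unfolding xy using assms by (intro mult_left_mono add_left_mono power_mono) auto
  also have "\<dots> \<le> (1 + M\<^sup>2) * ((1 + (norm a)\<^sup>2) * (1 + M\<^sup>2)) * (1 + (norm a)\<^sup>2)"
    by (simp add: mult_le_cancel_left1 distrib_left)
  also have "\<dots> = ((1 + M\<^sup>2) * (1 + (norm a)\<^sup>2))\<^sup>2" by (simp add: power2_eq_square)
  finally have "M * x + y \<le> (1 + M\<^sup>2) * (1 + (norm a)\<^sup>2)"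
    by (rule power2_le_imp_le) auto
  moreover have "norm (1 + complex_of_real ((norm a)\<^sup>2)) = 1 + (norm a)\<^sup>2"
    by (metis abs_of_nonneg add_nonneg_nonneg norm_of_real of_real_1 of_real_add zero_le_one zero_le_power2)
  ultimately show ?thesis
    using 1 by (simp add: norm_divide divide_le_eq add_pos_nonneg)
qed

text \<open>Over the common denominator this is the identity
  \<open>cnj a * g z * (h w + a) = |a|\<^sup>2 (g z + h w) + cnj a * (g z - a) * h w\<close>, whose last term is
  \<open>cnj a * s * g1 * h1\<close> on the hyperbola.\<close>

lemma bilinear_extension:
  fixes g h :: "complex \<Rightarrow> complex"
  assumes "z * w = s" "g z = a + z * g1" "h w = w * h1"
  shows "(g z + (h w + a) - a + cnj a * g z * (h w + a)) / (1 + (norm a)\<^sup>2)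
      + - (cnj a / (1 + (norm a)\<^sup>2)) * (s * g1 * h1) = g z + h w"
proof -
  define D :: complex where "D = 1 + (norm a)\<^sup>2"
  have D: "D = 1 + a * cnj a" by (simp add: D_def complex_norm_square flip: of_real_power)
  have "D = complex_of_real (1 + (norm a)\<^sup>2)" by (simp add: D_def)
  moreover have "1 + (norm a)\<^sup>2 \<noteq> 0" using zero_le_power2[of "norm a"] by linarith
  ultimately have D0: "D \<noteq> 0" by (simp only: of_real_eq_0_iff not_False_eq_True)
  have "g z + (h w + a) - a + cnj a * g z * (h w + a) - cnj a * (s * g1 * h1) = (g z + h w) * D"
    by (simp add: D assms(1)[symmetric] assms(2,3) algebra_simps)
  then have "(g z + (h w + a) - a + cnj a * g z * (h w + a) - cnj a * (s * g1 * h1)) / D = g z + h w"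
    using D0 by simp
  then show ?thesis by (simp add: D_def diff_divide_distrib)
qed

section \<open>Holomorphy in two variables\<close>

lemma holomorphic2_on_iff:
  "holomorphic2_on F U \<longleftrightarrow> (\<forall>p\<in>U. \<exists>a b. (F has_derivative (\<lambda>q. a * fst q + b * snd q)) (at p))"
  by (simp add: holomorphic2_on_def case_prod_unfold)

lemma holomorphic2_on_const: "holomorphic2_on (\<lambda>_. c) U"
  unfolding holomorphic2_on_iff by (auto intro!: exI[of _ 0])

lemma holomorphic2_on_fst:
  assumes "g holomorphic_on ball 0 1"
  shows "holomorphic2_on (\<lambda>p. g (fst p)) bidisk"
  unfolding holomorphic2_on_iff
proof
  fix p :: "complex \<times> complex" assume "p \<in> bidisk"
  then have "fst p \<in> ball 0 1" by (auto simp: bidisk_def unit_disk_def)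
  then obtain d where d: "(g has_field_derivative d) (at (fst p))"
    using assms unfolding holomorphic_on_open[OF open_ball] by blast
  have "((\<lambda>p. g (fst p)) has_derivative (\<lambda>q. d * fst q)) (at p)"
    by (rule has_derivative_compose[OF has_derivative_fst[OF has_derivative_ident]
          d[unfolded has_field_derivative_def]])
  then show "\<exists>a b. ((\<lambda>p. g (fst p)) has_derivative (\<lambda>q. a * fst q + b * snd q)) (at p)"
    by (intro exI[of _ d] exI[of _ 0]) simp
qed

lemma holomorphic2_on_snd:
  assumes "g holomorphic_on ball 0 1"
  shows "holomorphic2_on (\<lambda>p. g (snd p)) bidisk"
  unfolding holomorphic2_on_iff
proof
  fix p :: "complex \<times> complex" assume "p \<in> bidisk"
  then have "snd p \<in> ball 0 1" by (auto simp: bidisk_def unit_disk_def)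
  then obtain d where d: "(g has_field_derivative d) (at (snd p))"
    using assms unfolding holomorphic_on_open[OF open_ball] by blast
  have "((\<lambda>p. g (snd p)) has_derivative (\<lambda>q. d * snd q)) (at p)"
    by (rule has_derivative_compose[OF has_derivative_snd[OF has_derivative_ident]
          d[unfolded has_field_derivative_def]])
  then show "\<exists>a b. ((\<lambda>p. g (snd p)) has_derivative (\<lambda>q. a * fst q + b * snd q)) (at p)"
    by (intro exI[of _ 0] exI[of _ d]) simp
qed

lemma holomorphic2_on_add:
  assumes "holomorphic2_on F U" "holomorphic2_on G U"
  shows "holomorphic2_on (\<lambda>p. F p + G p) U"
  unfolding holomorphic2_on_iff
proof
  fix p assume "p \<in> U"
  then obtain a b c d where "(F has_derivative (\<lambda>q. a * fst q + b * snd q)) (at p)"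
    "(G has_derivative (\<lambda>q. c * fst q + d * snd q)) (at p)"
    using assms unfolding holomorphic2_on_iff by blast
  from has_derivative_add[OF this]
  show "\<exists>a b. ((\<lambda>p. F p + G p) has_derivative (\<lambda>q. a * fst q + b * snd q)) (at p)"
    by (intro exI[of _ "a + c"] exI[of _ "b + d"]) (simp add: algebra_simps)
qed

lemma holomorphic2_on_mult:
  assumes "holomorphic2_on F U" "holomorphic2_on G U"
  shows "holomorphic2_on (\<lambda>p. F p * G p) U"
  unfolding holomorphic2_on_iff
proof
  fix p assume "p \<in> U"
  then obtain a b c d where "(F has_derivative (\<lambda>q. a * fst q + b * snd q)) (at p)"
    "(G has_derivative (\<lambda>q. c * fst q + d * snd q)) (at p)"
    using assms unfolding holomorphic2_on_iff by blast
  from has_derivative_mult[OF this]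
  show "\<exists>a b. ((\<lambda>p. F p * G p) has_derivative (\<lambda>q. a * fst q + b * snd q)) (at p)"
    by (intro exI[of _ "F p * c + a * G p"] exI[of _ "F p * d + b * G p"]) (simp add: algebra_simps)
qed

section \<open>The extension theorem\<close>

text \<open>The quotients \<open>g1\<close>, \<open>h1\<close> enter only with the factor \<open>s\<close>, so crude absolute bounds suffice: for
  \<open>s \<le> 1/4\<close> the previous estimates give \<open>|g| \<le> 3\<close> and \<open>|h + a| \<le> 4\<close>, hence the constants 6 and 7.
  The final bound collects \<open>(1 + 12 s)\<^sup>2 \<le> 1 + 60 s\<close> and at most \<open>40 s\<close> from the correction.\<close>

lemma normalized_extension:
  fixes \<phi> :: "complex \<Rightarrow> complex"
  assumes hol: "\<phi> holomorphic_on {z. s < norm z \<and> norm z < 1}"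
    and bound: "\<And>z. s < norm z \<Longrightarrow> norm z < 1 \<Longrightarrow> norm (\<phi> z) \<le> 1"
    and s: "0 < s" "s \<le> 1/4"
  obtains F where "holomorphic2_on F bidisk" "\<And>p. p \<in> bidisk \<Longrightarrow> norm (F p) \<le> 2 + 100 * s"
    "\<And>z w. s < norm z \<Longrightarrow> norm z < 1 \<Longrightarrow> z * w = of_real s \<Longrightarrow> F (z, w) = \<phi> z"
proof -
  obtain g h where g: "g holomorphic_on ball 0 1" and h: "h holomorphic_on ball 0 1" "h 0 = 0"
    and gh: "\<And>z. s < norm z \<Longrightarrow> norm z < 1 \<Longrightarrow> \<phi> z = g z + h (of_real s / z)"
    using annulus_splitting[OF hol s(1)] s by auto
  define a where "a = g 0"
  note bd = splitting_bounds[OF g h s, folded a_def]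
  have G: "norm (g z) \<le> 1 + 8 * s" and H: "norm (h z + a) \<le> 1 + 12 * s" if "norm z < 1" for z
    using bd[OF _ that] bound gh by auto
  have g0hol: "(\<lambda>z. g z - a) holomorphic_on ball 0 1" using g by (intro holomorphic_intros)
  obtain g1 where g1: "g1 holomorphic_on ball 0 1" "\<And>z. g z - a = z * g1 z"
    using holomorphic_divide_zero[OF g0hol] by (auto simp: a_def)
  obtain h1 where h1: "h1 holomorphic_on ball 0 1" "\<And>z. h z = z * h1 z"
    using holomorphic_divide_zero[OF h] by blast
  have a3: "norm a \<le> 3" using G[of 0] s by (simp add: a_def)
  have G1: "norm (g1 x) \<le> 6 / (3/4)" and H1: "norm (h1 x) \<le> 7 / (3/4)" if x: "norm x < 1" for x
  proof -
    define t where "t = max (norm x) (3/4)"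
    have t: "3/4 \<le> t" "t < 1" "0 < t" "norm x \<le> t" using x by (auto simp: t_def)
    have "norm (g1 x) \<le> 6 / t"
    proof (rule divide_zero_bound[OF g1 t(3,2) _ t(4)])
      show "norm (g z - a) \<le> 6" if "norm z = t" for z
        using G[of z] a3 norm_triangle_ineq4[of "g z" a] that t s by simp
    qed
    also have "\<dots> \<le> 6 / (3/4)" using t by (intro divide_left_mono) auto
    finally show "norm (g1 x) \<le> 6 / (3/4)" .
    have "norm (h1 x) \<le> 7 / t"
    proof (rule divide_zero_bound[OF h1 t(3,2) _ t(4)])
      show "norm (h z) \<le> 7" if "norm z = t" for z
        using H[of z] a3 norm_triangle_ineq4[of "h z + a" a] that t s by simp
    qed
    also have "\<dots> \<le> 7 / (3/4)" using t by (intro divide_left_mono) auto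
    finally show "norm (h1 x) \<le> 7 / (3/4)" .
  qed
  define k :: complex where "k = 1 + (norm a)\<^sup>2"
  have k: "norm k = 1 + (norm a)\<^sup>2"
    unfolding k_def by (metis abs_of_nonneg add_nonneg_nonneg norm_of_real zero_le_one zero_le_power2)
  define F where "F = (\<lambda>p. (g (fst p) + (h (snd p) + a) - a + cnj a * g (fst p) * (h (snd p) + a)) / k
      + - (cnj a / k) * (of_real s * g1 (fst p) * h1 (snd p)))"
  have "holomorphic2_on F bidisk"
    unfolding F_def divide_inverse diff_conv_add_uminus
    by (intro holomorphic2_on_add holomorphic2_on_mult holomorphic2_on_const
        holomorphic2_on_fst holomorphic2_on_snd g h g1 h1)
  moreover have "norm (F p) \<le> 2 + 100 * s" if "p \<in> bidisk" for p
  proof -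
    have p: "norm (fst p) < 1" "norm (snd p) < 1" using that by (auto simp: bidisk_def unit_disk_def)
    have "norm ((g (fst p) + (h (snd p) + a) - a + cnj a * g (fst p) * (h (snd p) + a)) / k) \<le> 1 + (1 + 12 * s)\<^sup>2"
      using bilinear_bound[of "g (fst p)" "1 + 12 * s" "h (snd p) + a" a] G[OF p(1)] H[OF p(2)] s
      by (simp add: k_def)
    also have "(1 + 12 * s)\<^sup>2 \<le> 1 + 60 * s"
      using mult_left_mono[OF s(2), of s] s by (simp add: power2_eq_square algebra_simps)
    finally have 1: "norm ((g (fst p) + (h (snd p) + a) - a + cnj a * g (fst p) * (h (snd p) + a)) / k)
        \<le> 2 + 60 * s" by simp
    have "norm a / (1 + (norm a)\<^sup>2) \<le> 1 / 2"
      using zero_le_power2[of "norm a - 1"] by (simp add: divide_le_eq power2_eq_square algebra_simps add_pos_nonneg)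
    then have "norm (cnj a / k) \<le> 1 / 2" by (simp add: norm_divide k)
    moreover have "norm (of_real s * g1 (fst p) * h1 (snd p)) \<le> s * (6 / (3/4)) * (7 / (3/4))"
      using G1[OF p(1)] H1[OF p(2)] s unfolding norm_mult by (intro mult_mono) auto
    ultimately have "norm (- (cnj a / k) * (of_real s * g1 (fst p) * h1 (snd p)))
        \<le> 1 / 2 * (s * (6 / (3/4)) * (7 / (3/4)))"
      unfolding norm_mult[of "- (cnj a / k)"] norm_minus_cancel by (intro mult_mono) auto
    also have "\<dots> \<le> 40 * s" using s by simp
    finally show ?thesis
      unfolding F_def using 1 by (intro norm_triangle_le) linarith
  qed
  moreover have "F (z, w) = \<phi> z" if "s < norm z" "norm z < 1" "z * w = of_real s" for z w
  proof -
    have "z \<noteq> 0" using that(1) s by auto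
    then have w: "of_real s / z = w" using that(3) by (simp add: field_simps)
    have "g z = a + z * g1 z" using g1(2)[of z] by (simp add: algebra_simps)
    then show ?thesis
      using bilinear_extension[OF that(3), of g a "g1 z" h "h1 w"] h1(2)[of w] gh[OF that(1,2)]
      by (simp add: F_def k_def w add.assoc)
  qed
  ultimately show ?thesis using that by blast
qed

theorem mainTheorem3:
  shows "\<exists>C R :: real. C > 0 \<and> R > 1 \<and>
    (\<forall>r \<ge> R. \<forall>f :: complex \<times> complex \<Rightarrow> complex.
       holomorphic_on_hyperbola r f \<longrightarrow> bounded (f ` hyperbola r) \<longrightarrow>
       (\<exists>p\<in>hyperbola r. f p \<noteq> 0) \<longrightarrow>
       extension_constant r f \<le> ereal (2 + C / r\<^sup>2))"
proof (rule exI[of _ 100], rule exI[of _ 2], intro conjI allI impI)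
  fix r :: real and f :: "complex \<times> complex \<Rightarrow> complex"
  assume r: "2 \<le> r" and hol: "holomorphic_on_hyperbola r f" and bd: "bounded (f ` hyperbola r)"
    and nz: "\<exists>p\<in>hyperbola r. f p \<noteq> 0"
  define s where "s = 1 / r\<^sup>2"
  have s: "0 < s" "s \<le> 1/4"
    using r power_mono[OF r, of 2] by (auto simp: s_def field_simps)
  define N where "N = sup_norm (hyperbola r) f"
  have le_N: "norm (f p) \<le> N" if "p \<in> hyperbola r" for p
    unfolding N_def sup_norm_def using bd that
    by (intro cSUP_upper) (auto simp: bounded_iff bdd_above_def)
  have N: "N > 0" using nz le_N by (metis less_le_trans zero_less_norm_iff)
  have param: "hyperbola_param r z \<in> hyperbola r" if "s < norm z" "norm z < 1" for z
    using bij_betw_apply[OF hyperbola_param_bij_betw[of r]] r that by (auto simp: annulus_def s_def)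
  define \<phi> where "\<phi> = (\<lambda>z. f (hyperbola_param r z) / of_real N)"
  have "\<phi> holomorphic_on {z. s < norm z \<and> norm z < 1}"
    unfolding \<phi>_def using hol N
    by (intro holomorphic_on_divide) (auto simp: holomorphic_on_hyperbola_def annulus_def s_def o_def)
  moreover have "norm (\<phi> z) \<le> 1" if "s < norm z" "norm z < 1" for z
    using le_N[OF param[OF that]] N by (simp add: \<phi>_def norm_divide)
  ultimately obtain F where F: "holomorphic2_on F bidisk"
    "\<And>p. p \<in> bidisk \<Longrightarrow> norm (F p) \<le> 2 + 100 * s"
    "\<And>z w. s < norm z \<Longrightarrow> norm z < 1 \<Longrightarrow> z * w = of_real s \<Longrightarrow> F (z, w) = \<phi> z"
    using normalized_extension[OF _ _ s] by blast
  define E where "E = (\<lambda>p. of_real N * F p)"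
  have E_le: "norm (E p) \<le> N * (2 + 100 * s)" if "p \<in> bidisk" for p
    unfolding E_def norm_mult using F(2)[OF that] N by simp
  have "E p = f p" if p: "p \<in> hyperbola r" for p
  proof -
    obtain z where z: "s < norm z" "norm z < 1" "p = hyperbola_param r z"
      using p bij_betw_imp_surj_on[OF hyperbola_param_bij_betw[of r]] r
      by (force simp: annulus_def s_def)
    have "z \<noteq> 0" using z(1) s by auto
    then have "F p = \<phi> z"
      unfolding z(3) hyperbola_param_def by (intro F(3) z) (use r in \<open>auto simp: s_def\<close>)
    then show ?thesis using N by (simp add: E_def \<phi>_def z(3))
  qed
  moreover have "E \<in> H_infinity bidisk"
    using holomorphic2_on_mult[OF holomorphic2_on_const F(1), of "of_real N"] E_le
    unfolding H_infinity_def E_def bounded_iff by blast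
  ultimately have "E \<in> bounded_extensions r f" by (simp add: bounded_extensions_def)
  then have "extension_constant r f \<le> ereal (sup_norm bidisk E / N)"
    unfolding extension_constant_def N_def by (rule INF_lower)
  also have "sup_norm bidisk E \<le> N * (2 + 100 * s)"
    unfolding sup_norm_def using E_le
    by (intro cSUP_least) (auto simp: bidisk_def unit_disk_def)
  then have "ereal (sup_norm bidisk E / N) \<le> ereal (2 + 100 / r\<^sup>2)"
    using N by (simp add: s_def field_simps)
  finally show "extension_constant r f \<le> ereal (2 + 100 / r\<^sup>2)" .
qed auto

end
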